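(* Let $R:X\to\mathbb{R}\cup\{\infty\}$ be convex and satisfy (R1)--(R4) (listed in the context). Suppose that there is $\theta\in[0,1]$ such that $$R(u-v)\le C_\theta(u,v)\,\big(D_R^{\mu_u,\mu_v}(u,v)\big)^\theta$$ for all $u,v\in X$, $\mu_u\in\partial R(u)$, $\mu_v\in\partial R(v)$, where $C_\theta(u,v)$ is bounded on sets where $R(u)$ and $R(v)$ are bounded. Let $\alpha,\delta>0$, let $u_\alpha^\delta$ be a minimizer of $J_\alpha^\delta$ with subgradient $\mu_\alpha^\delta\in\partial R(u_\alpha^\delta)$ from the optimality condition $K^*(Ku_\alpha^\delta-f^\delta)+\alpha\mu_\alpha^\delta=0$, let $\mu^\dagger\in\partial R(u^\dagger)$ and $\eta=K^*n$. Then, if $\theta<1$, $$D_R^{\mu_\alpha^\delta,\mu^\dagger}(u_\alpha^\delta,u^\dagger)\le\inf_{(\zeta_1,\zeta_2)\in\mathbb{R}_+^2}\left\{\Big(\zeta_1+\frac{\delta}{\alpha}\zeta_2\Big)^{\frac1{1-\theta}}C_\theta(u_\alpha^\delta,u^\dagger)^{\frac1{1-\theta}}+\frac{1}{1-\theta}e_{\alpha,\zeta_1}(\mu^\dagger)+\frac{\delta}{\alpha(1-\theta)}e_{\delta,\zeta_2}(\eta)\right\}.$$ If $\theta=1$, then $$D_R^{\mu_\alpha^\delta,\mu^\dagger}(u_\alpha^\delta,u^\dagger)\le\inf_{(\zeta_1,\zeta_2)\in\Sigma}\frac{e_{\alpha,\zeta_1}(\mu^\dagger)+\frac{\delta}{\alpha}e_{\delta,\zeta_2}(\eta)}{1-\big(\zeta_1+\frac{\delta}{\alpha}\zeta_2\big)C_1(u_\alpha^\delta,u^\dagger)},$$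 where $\Sigma=\{(\zeta_1,\zeta_2)\in\mathbb{R}_+^2:\ (\zeta_1+\frac{\delta}{\alpha}\zeta_2)\,C_1(u_\alpha^\delta,u^\dagger)<1\}$.
   Context: $\mathbb{R}_+$ denotes the positive reals. $X$ is a separable Banach space and $Y$ a separable Hilbert space, identified with its dual. $(Z,Y,Z^* )$ is a Gelfand triple: $Z\subset Y$ is a dense subspace with Banach space structure and $\langle u,v\rangle_{Z\times Z^*}=\langle u,v\rangle_Y$ for $u\in Z$, $v\in Y\subset Z^*$. $K:X\to Y$ is a continuous linear operator, also continuous as a map $X\to Z$; its adjoint extends continuously to $K^*:Z^*\to X^*$. The noisy data are $f^\delta=Ku^\dagger+\delta n\in Z^*$ with $n\in Z^*$, where $u^\dagger\in X$ is a solution of $Ku=f$ minimizing $R$ among all solutions. The functional is $$J_\alpha^\delta(u)=\tfrac12\|Ku\|_Y^2-\langle Ku,f^\delta\rangle_{Z\times Z^*}+\alpha R(u).$$ Subdifferential: $\partial R(u)=\{\mu\in X^*: R(u)-R(v)\le\langle\mu,u-v\rangle_{X^*\times X}\ \forall v\in X\}$. Symmetric Bregman distance: $D_R^{\mu_u,\mu_v}(u,v)=\langle\mu_u-\mu_v,u-v\rangle_{X^*\times X}$ for $\mu_u\in\partial R(u)$, $\mu_v\in\partial R(v)$ (with the convention $D^0=1$ when $\theta=0$). Convex conjugate: $R^\star(q)=\sup_{u\in X}(\langle q,u\rangle-R(u))$. For $\alpha,\zeta>0$ and $\vartheta\in X^*$, $$e_{\alpha,\zeta}(\vartheta)=\inf_{w\in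 Y}\left\{\zeta R^\star\!\left(\frac{K^*w-\vartheta}{\zeta}\right)+\frac{\alpha}{2}\|w\|_Y^2\right\}.$$ Assumptions on $R$: (R1) $R$ is lower semicontinuous in some topology $\tau$ on $X$; (R2) the sublevel sets $\{R\le\rho\}$ are sequentially compact in $\tau$; (R3) $R^\star$ is finite on a ball in $X^*$ centered at zero; (R4) $R(-u)=R(u)$ for all $u\in X$. It is also assumed that $K:X\to Z$ is continuous with respect to $\tau$. *)

theory Defs
  imports "HOL-Analysis.Analysis"
begin

text \<open>A dual space is the type of bounded linear functionals \<open>'a \<Rightarrow>\<^sub>L real\<close>, and functionals
  \<open>R\<close> with values in the reals extended by \<open>\<infinity>\<close> are \<open>ereal\<close>-valued functions omitting \<open>-\<infinity>\<close>.\<close>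

section \<open>Gelfand triple and adjoint\<close>

text \<open>The dense subspace \<open>Z\<close> of \<open>Y\<close>, having its own Banach norm, is a separate Banach space together
  with a continuous injection \<open>\<iota>\<close> into \<open>Y\<close>. Continuity of \<open>\<iota>\<close> is what makes
  \<open>u \<mapsto> \<langle>u, v\<rangle>\<^sub>Y\<close> an element of the dual of \<open>Z\<close> for every \<open>v\<close> in \<open>Y\<close>.\<close>

definition gelfand_triple :: "('z::banach \<Rightarrow>\<^sub>L 'y::{real_inner,banach}) \<Rightarrow> bool" where
  "gelfand_triple \<iota> \<longleftrightarrow> inj (blinfun_apply \<iota>) \<and> closure (range (blinfun_apply \<iota>)) = UNIV"

text \<open>The inclusion of \<open>Y\<close> into the dual of \<open>Z\<close>: the functional \<open>u \<mapsto> \<langle>u, v\<rangle>\<^sub>Y\<close> on \<open>Z\<close>.\<close>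

definition gelfand_embed :: "('z::banach \<Rightarrow>\<^sub>L 'y::{real_inner,banach}) \<Rightarrow> 'y \<Rightarrow> ('z \<Rightarrow>\<^sub>L real)" where
  "gelfand_embed \<iota> v = blinfun_inner_right v o\<^sub>L \<iota>"

definition dual_adjoint ::
  "('a::real_normed_vector \<Rightarrow>\<^sub>L 'b::real_normed_vector) \<Rightarrow> ('b \<Rightarrow>\<^sub>L real) \<Rightarrow> ('a \<Rightarrow>\<^sub>L real)" where
  "dual_adjoint A \<phi> = \<phi> o\<^sub>L A"

text \<open>The adjoint of \<open>K\<close> as a map into \<open>Z\<close> extends the adjoint of \<open>K\<close> as a map into the Hilbert space
  \<open>Y\<close> (identified with its dual).\<close>

lemma dual_adjoint_gelfand_embed:
  "dual_adjoint KZ (gelfand_embed \<iota> w) = dual_adjoint (\<iota> o\<^sub>L KZ) (blinfun_inner_right w)"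
  by (rule blinfun_eqI) (simp add: dual_adjoint_def gelfand_embed_def)

section \<open>Convex functionals\<close>

definition ereal_convex :: "('x::real_vector \<Rightarrow> ereal) \<Rightarrow> bool" where
  "ereal_convex R \<longleftrightarrow> (\<forall>u v. \<forall>t\<in>{0..1::real}.
     R (t *\<^sub>R u + (1 - t) *\<^sub>R v) \<le> ereal t * R u + ereal (1 - t) * R v)"

definition lsc_in :: "'x topology \<Rightarrow> ('x \<Rightarrow> ereal) \<Rightarrow> bool" where
  "lsc_in T R \<longleftrightarrow> (\<forall>c. openin T {u \<in> topspace T. c < R u})"

definition seq_compact_in :: "'x topology \<Rightarrow> 'x set \<Rightarrow> bool" where
  "seq_compact_in T S \<longleftrightarrow> (\<forall>s :: nat \<Rightarrow> 'x. (\<forall>i. s i \<in> S) \<longrightarrow>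
     (\<exists>l\<in>S. \<exists>r. strict_mono r \<and> limitin T (s \<circ> r) l sequentially))"

definition convex_conjugate ::
  "('x::real_normed_vector \<Rightarrow> ereal) \<Rightarrow> ('x \<Rightarrow>\<^sub>L real) \<Rightarrow> ereal" where
  "convex_conjugate R q = (SUP u. ereal (q u) - R u)"

text \<open>Since \<open>\<infinity> - \<infinity> = \<infinity>\<close> in \<open>ereal\<close>, the subdifferential is empty at points where \<open>R u = \<infinity>\<close>.\<close>

definition subdifferential ::
  "('x::real_normed_vector \<Rightarrow> ereal) \<Rightarrow> 'x \<Rightarrow> ('x \<Rightarrow>\<^sub>L real) set" where
  "subdifferential R u = {\<mu> :: 'x \<Rightarrow>\<^sub>L real. \<forall>v. R u - R v \<le> ereal (\<mu> (u - v))}"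

definition sym_bregman ::
  "('x::real_normed_vector \<Rightarrow>\<^sub>L real) \<Rightarrow> ('x \<Rightarrow>\<^sub>L real) \<Rightarrow> 'x \<Rightarrow> 'x \<Rightarrow> real" where
  "sym_bregman \<mu> \<nu> u v = (\<mu> - \<nu>) (u - v)"

text \<open>The power of a Bregman distance, with \<open>D\<^sup>0 = 1\<close> also for \<open>D = 0\<close> (whereas \<open>0 powr 0 = 0\<close>).\<close>

definition bregman_pow :: "real \<Rightarrow> real \<Rightarrow> real" where
  "bregman_pow D \<theta> = (if \<theta> = 0 then 1 else D powr \<theta>)"

section \<open>The regularization functional\<close>

definition J_fun :: "('z::banach \<Rightarrow>\<^sub>L 'y::{real_inner,banach}) \<Rightarrow> ('x::banach \<Rightarrow>\<^sub>L 'z) \<Rightarrow>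
    ('x \<Rightarrow> ereal) \<Rightarrow> real \<Rightarrow> ('z \<Rightarrow>\<^sub>L real) \<Rightarrow> 'x \<Rightarrow> ereal" where
  "J_fun \<iota> KZ R \<alpha> f u =
     ereal ((norm (\<iota> (KZ u)))\<^sup>2 / 2 - f (KZ u)) + ereal \<alpha> * R u"

definition e_fun :: "('x::banach \<Rightarrow>\<^sub>L 'y::{real_inner,banach}) \<Rightarrow> ('x \<Rightarrow> ereal) \<Rightarrow>
    real \<Rightarrow> real \<Rightarrow> ('x \<Rightarrow>\<^sub>L real) \<Rightarrow> ereal" where
  "e_fun K R \<alpha> \<zeta> \<xi> = (INF w.
     ereal \<zeta> * convex_conjugate R ((dual_adjoint K (blinfun_inner_right w) - \<xi>) /\<^sub>R \<zeta>)
     + ereal (\<alpha> / 2 * (norm w)\<^sup>2))"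

end

theory Submission
  imports Defs
begin

text \<open>Put \<open>d = u\<^sub>\<alpha> - u\<^sub>0\<close> and \<open>s = \<zeta>\<^sub>1 + \<delta> / \<alpha> * \<zeta>\<^sub>2\<close>. Testing the optimality condition with \<open>d\<close>
  gives an identity for the Bregman distance \<open>D\<close>,
  \<open>D = \<delta> / \<alpha> * \<eta> d - \<mu>\<^sub>0 d - (norm (K d))\<^sup>2 / \<alpha>\<close> (\<open>sym_bregman_error_identity\<close>).
  If \<open>\<mu>\<^sub>0\<close> and \<open>\<eta>\<close> were of the form \<open>K\<^sup>* w\<close>, the linear terms could be absorbed
  into the quadratic one. In general, the functional \<open>e\<close> measures the failure of such a source
  condition: the Fenchel--Young inequality for the residual \<open>K\<^sup>* w - \<xi>\<close>, together with Young's
  inequality for \<open>\<langle>w, K d\<rangle>\<close>, bounds \<open>- \<xi> d\<close> by \<open>e(\<xi>)\<close>, a multiple of \<open>R d\<close>, and a multiple of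
  \<open>(norm (K d))\<^sup>2\<close> (\<open>e_fun_lower_bound\<close>). This estimate is used for \<open>\<mu>\<^sub>0\<close> at \<open>d\<close> and for
  \<open>\<eta>\<close> at \<open>- d\<close>, where \<open>R (- d) = R d\<close>. The two multiples of \<open>(norm (K d))\<^sup>2\<close> are each half of the
  quadratic term of the identity, so they cancel it exactly and
  \<open>D \<le> s * R d + e(\<mu>\<^sub>0) + \<delta> / \<alpha> * e(\<eta>)\<close>.

  Finally \<open>R d \<le> C * D\<^sup>\<theta>\<close>. If \<open>\<theta> = 1\<close>, the term \<open>s * C * D\<close> is moved to the left. If \<open>\<theta> < 1\<close>, Young's
  inequality (\<open>weighted_young\<close>) bounds \<open>s * C * D\<^sup>\<theta>\<close> by
  \<open>(1 - \<theta>) * (s * C)\<^bsup>1/(1 - \<theta>)\<^esup> + \<theta> * D\<close>, and \<open>\<theta> * D\<close> is absorbed.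

  All estimates for the extended-real functional \<open>e\<close> are stated as lower bounds by real numbers.
  Sums such as \<open>\<infinity> + (-\<infinity>)\<close> are thereby excluded.\<close>

section \<open>Subgradients and conjugates\<close>

lemma subdifferential_finite:
  assumes "\<mu> \<in> subdifferential R u" and "R u \<noteq> -\<infinity>"
  shows "\<bar>R u\<bar> \<noteq> \<infinity>"
  using assms(1)[unfolded subdifferential_def, simplified, rule_format, of u] assms(2)
  by (cases "R u") auto

text \<open>Subdifferentials are monotone operators: the two subgradient inequalities are added.\<close>

lemma sym_bregman_nonneg:
  assumes "\<mu> \<in> subdifferential R u" and "\<nu> \<in> subdifferential R v"
    and "R u \<noteq> -\<infinity>" and "R v \<noteq> -\<infinity>"
  shows "0 \<le> sym_bregman \<mu> \<nu> u v"
proof -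
  obtain a where a: "R u = ereal a"
    using subdifferential_finite[OF assms(1,3)] by (cases "R u") auto
  obtain b where b: "R v = ereal b"
    using subdifferential_finite[OF assms(2,4)] by (cases "R v") auto
  have "R u - R v \<le> ereal (\<mu> (u - v))" and "R v - R u \<le> ereal (\<nu> (v - u))"
    using assms(1,2) by (auto simp: subdifferential_def)
  then show ?thesis
    by (simp add: a b sym_bregman_def blinfun.diff_left blinfun.diff_right)
qed

lemma fenchel_young:
  fixes q :: "'x::real_normed_vector \<Rightarrow>\<^sub>L real"
  assumes "R u = ereal r"
  shows "ereal (q u - r) \<le> convex_conjugate R q"
  unfolding convex_conjugate_def
  by (rule SUP_upper2[of u]) (simp_all add: assms)

text \<open>The infimum defining \<open>e\<close> runs over approximate sources \<open>w\<close> for \<open>\<xi>\<close>. For each of them the residual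
  is estimated by Fenchel--Young at \<open>u\<close>, which leaves the term \<open>\<langle>w, K u\<rangle>\<close>. This term is compensated by
  \<open>\<alpha> / 2 * (norm w)\<^sup>2\<close> at the price of \<open>(norm (K u))\<^sup>2 / (2 * \<alpha>)\<close>, by completing a square.\<close>

lemma e_fun_lower_bound:
  fixes K :: "'x::banach \<Rightarrow>\<^sub>L 'y::{real_inner,banach}" and \<xi> :: "'x \<Rightarrow>\<^sub>L real"
  assumes \<alpha>: "\<alpha> > 0" and \<zeta>: "\<zeta> > 0" and r: "R u = ereal r"
  shows "ereal (- \<xi> u - \<zeta> * r - (norm (K u))\<^sup>2 / (2 * \<alpha>)) \<le> e_fun K R \<alpha> \<zeta> \<xi>"
  unfolding e_fun_def
proof (rule INF_greatest)
  fix w :: 'y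
  define q where "q = (dual_adjoint K (blinfun_inner_right w) - \<xi>) /\<^sub>R \<zeta>"
  have q: "\<zeta> * q u = w \<bullet> K u - \<xi> u"
    using \<zeta> by (simp add: q_def dual_adjoint_def blinfun.diff_left blinfun.scaleR_left)
  have "0 \<le> (norm (\<alpha> *\<^sub>R w + K u))\<^sup>2 / (2 * \<alpha>)"
    using \<alpha> by simp
  also have "\<dots> = \<alpha> / 2 * (norm w)\<^sup>2 + w \<bullet> K u + (norm (K u))\<^sup>2 / (2 * \<alpha>)"
    unfolding power2_norm_eq_inner inner_add_left inner_add_right inner_scaleR_left inner_scaleR_right
    using \<alpha> by (simp add: inner_commute field_simps)
  finally have "- \<xi> u - \<zeta> * r - (norm (K u))\<^sup>2 / (2 * \<alpha>) \<le> \<zeta> * (q u - r) + \<alpha> / 2 * (norm w)\<^sup>2"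
    using q by (simp add: right_diff_distrib)
  then have "ereal (- \<xi> u - \<zeta> * r - (norm (K u))\<^sup>2 / (2 * \<alpha>)) \<le>
      ereal \<zeta> * ereal (q u - r) + ereal (\<alpha> / 2 * (norm w)\<^sup>2)"
    by simp
  also have "\<dots> \<le> ereal \<zeta> * convex_conjugate R q + ereal (\<alpha> / 2 * (norm w)\<^sup>2)"
    using \<zeta> by (intro add_right_mono ereal_mult_left_mono fenchel_young r) simp_all
  finally show "ereal (- \<xi> u - \<zeta> * r - (norm (K u))\<^sup>2 / (2 * \<alpha>)) \<le>
      ereal \<zeta> * convex_conjugate R ((dual_adjoint K (blinfun_inner_right w) - \<xi>) /\<^sub>R \<zeta>)
      + ereal (\<alpha> / 2 * (norm w)\<^sup>2)"
    by (simp only: q_def)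
qed

section \<open>Young's inequality and the error identity\<close>

text \<open>For \<open>0 < \<theta>\<close> and \<open>0 \<le> c\<close> this is Young's inequality with exponents \<open>1 / (1 - \<theta>)\<close> and \<open>1 / \<theta>\<close>. The
  bound also holds for negative \<open>c\<close>, where the left-hand side is nonpositive: a functional \<open>R\<close>
  with negative values allows a negative constant \<open>C\<close>.\<close>

lemma weighted_young:
  assumes s: "s > 0" and D: "D \<ge> 0" and \<theta>: "0 \<le> \<theta>" "\<theta> < 1"
  shows "s * (c * bregman_pow D \<theta>) \<le>
    (1 - \<theta>) * (s powr (1 / (1 - \<theta>)) * c powr (1 / (1 - \<theta>))) + \<theta> * D"
proof (cases "c < 0")
  case True
  have "0 \<le> bregman_pow D \<theta>"
    by (simp add: bregman_pow_def)
  with True s have "s * (c * bregman_pow D \<theta>) \<le> 0"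
    by (simp add: mult_nonneg_nonpos mult_nonpos_nonneg)
  also have "0 \<le> (1 - \<theta>) * (s powr (1 / (1 - \<theta>)) * c powr (1 / (1 - \<theta>))) + \<theta> * D"
    using \<theta> D by simp
  finally show ?thesis .
next
  case False
  then have c: "c \<ge> 0" by simp
  show ?thesis
  proof (cases "\<theta> = 0")
    case True
    with c s show ?thesis by (simp add: bregman_pow_def)
  next
    case False
    with \<theta> have "(s * c) * D powr \<theta> \<le>
        (s * c) powr (1 / (1 - \<theta>)) / (1 / (1 - \<theta>)) + (D powr \<theta>) powr (1 / \<theta>) / (1 / \<theta>)"
      using s c by (intro Youngs_inequality) simp_all
    also have "\<dots> = (1 - \<theta>) * (s powr (1 / (1 - \<theta>)) * c powr (1 / (1 - \<theta>))) + \<theta> * D"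
      using False s c D by (simp add: powr_mult powr_powr)
    finally show ?thesis
      using False by (simp add: bregman_pow_def mult.assoc)
  qed
qed

lemma sym_bregman_error_identity:
  fixes \<iota> :: "'z::banach \<Rightarrow>\<^sub>L 'y::{real_inner,banach}" and KZ :: "'x::banach \<Rightarrow>\<^sub>L 'z"
  assumes \<alpha>: "\<alpha> > 0" and K: "K = \<iota> o\<^sub>L KZ"
    and optimality: "dual_adjoint KZ
      (gelfand_embed \<iota> (K u) - (gelfand_embed \<iota> (K v) + \<delta> *\<^sub>R n)) + \<alpha> *\<^sub>R \<mu> = 0"
  shows "sym_bregman \<mu> \<nu> u v =
    \<delta> / \<alpha> * dual_adjoint KZ n (u - v) - \<nu> (u - v) - (norm (K (u - v)))\<^sup>2 / \<alpha>"
proof -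
  have "(norm (K (u - v)))\<^sup>2 - \<delta> * dual_adjoint KZ n (u - v) + \<alpha> * \<mu> (u - v) =
      (dual_adjoint KZ (gelfand_embed \<iota> (K u) - (gelfand_embed \<iota> (K v) + \<delta> *\<^sub>R n)) + \<alpha> *\<^sub>R \<mu>) (u - v)"
    unfolding K
    by (simp add: dual_adjoint_def gelfand_embed_def blinfun.add_left blinfun.diff_left
        blinfun.diff_right blinfun.scaleR_left power2_norm_eq_inner inner_diff_left inner_diff_right
        algebra_simps)
  also have "\<dots> = 0"
    by (simp add: optimality)
  finally have "\<mu> (u - v) = \<delta> / \<alpha> * dual_adjoint KZ n (u - v) - (norm (K (u - v)))\<^sup>2 / \<alpha>"
    using \<alpha> by (simp add: divide_simps algebra_simps)
  then show ?thesis
    by (simp add: sym_bregman_def blinfun.diff_left)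
qed

section \<open>The error estimates\<close>

theorem theorem2p9:
  fixes \<iota> :: "'z::banach \<Rightarrow>\<^sub>L 'y::{real_inner,banach}"
    and K :: "'x::banach \<Rightarrow>\<^sub>L 'y"
    and KZ :: "'x \<Rightarrow>\<^sub>L 'z"
    and R :: "'x \<Rightarrow> ereal"
    and \<tau> :: "'x topology"
    and C :: "'x \<Rightarrow> 'x \<Rightarrow> real"
    and \<theta> \<alpha> \<delta> :: real
    and f :: 'y
    and f\<delta> n :: "'z \<Rightarrow>\<^sub>L real"
    and u\<^sub>\<alpha> u\<^sub>0 :: 'x
    and \<mu>\<^sub>\<alpha> \<mu>\<^sub>0 \<eta> :: "'x \<Rightarrow>\<^sub>L real"
  assumes sepX: "separable_space (euclidean :: 'x topology)"
    and sepY: "separable_space (euclidean :: 'y topology)"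
    and gelfand: "gelfand_triple \<iota>"
    and K_factor: "K = \<iota> o\<^sub>L KZ"
    and R_values: "\<And>u. R u \<noteq> -\<infinity>"
    and R_convex: "ereal_convex R"
    and \<tau>_space: "topspace \<tau> = UNIV"
    and R1: "lsc_in \<tau> R"
    and R2: "\<And>\<rho>::real. seq_compact_in \<tau> {u. R u \<le> ereal \<rho>}"
    and R3: "\<exists>r>0. \<forall>q\<in>ball 0 r. \<bar>convex_conjugate R q\<bar> \<noteq> \<infinity>"
    and R4: "\<And>u. R (- u) = R u"
    and K_\<tau>: "continuous_map \<tau> euclidean (blinfun_apply KZ)"
    and \<theta>: "\<theta> \<in> {0..1}"
    and R_bound: "\<And>u v \<mu> \<nu>. \<mu> \<in> subdifferential R u \<Longrightarrow> \<nu> \<in> subdifferential R v \<Longrightarrow>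
          R (u - v) \<le> ereal (C u v * bregman_pow (sym_bregman \<mu> \<nu> u v) \<theta>)"
    and C_bounded: "\<And>\<rho>::real. bounded {C u v |u v. \<bar>R u\<bar> \<le> ereal \<rho> \<and> \<bar>R v\<bar> \<le> ereal \<rho>}"
    and pos: "\<alpha> > 0" "\<delta> > 0"
    and u\<^sub>0_solution: "K u\<^sub>0 = f"
    and u\<^sub>0_minimal: "\<And>u. K u = f \<Longrightarrow> R u\<^sub>0 \<le> R u"
    and data: "f\<delta> = gelfand_embed \<iota> (K u\<^sub>0) + \<delta> *\<^sub>R n"
    and u\<^sub>\<alpha>_minimizer: "\<And>u. J_fun \<iota> KZ R \<alpha> f\<delta> u\<^sub>\<alpha> \<le> J_fun \<iota> KZ R \<alpha> f\<delta> u"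
    and \<mu>\<^sub>\<alpha>: "\<mu>\<^sub>\<alpha> \<in> subdifferential R u\<^sub>\<alpha>"
    and optimality: "dual_adjoint KZ (gelfand_embed \<iota> (K u\<^sub>\<alpha>) - f\<delta>) + \<alpha> *\<^sub>R \<mu>\<^sub>\<alpha> = 0"
    and \<mu>\<^sub>0: "\<mu>\<^sub>0 \<in> subdifferential R u\<^sub>0"
    and \<eta>: "\<eta> = dual_adjoint KZ n"
  shows "(\<theta> < 1 \<longrightarrow>
      ereal (sym_bregman \<mu>\<^sub>\<alpha> \<mu>\<^sub>0 u\<^sub>\<alpha> u\<^sub>0) \<le>
        (INF (\<zeta>\<^sub>1, \<zeta>\<^sub>2) \<in> {0<..} \<times> {0<..}.
           ereal ((\<zeta>\<^sub>1 + \<delta> / \<alpha> * \<zeta>\<^sub>2) powr (1 / (1 - \<theta>)) * C u\<^sub>\<alpha> u\<^sub>0 powr (1 / (1 - \<theta>)))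
           + ereal (1 / (1 - \<theta>)) * e_fun K R \<alpha> \<zeta>\<^sub>1 \<mu>\<^sub>0
           + ereal (\<delta> / (\<alpha> * (1 - \<theta>))) * e_fun K R \<delta> \<zeta>\<^sub>2 \<eta>)) \<and>
    (\<theta> = 1 \<longrightarrow>
      ereal (sym_bregman \<mu>\<^sub>\<alpha> \<mu>\<^sub>0 u\<^sub>\<alpha> u\<^sub>0) \<le>
        (INF (\<zeta>\<^sub>1, \<zeta>\<^sub>2) \<in> {(\<zeta>\<^sub>1, \<zeta>\<^sub>2). \<zeta>\<^sub>1 > 0 \<and> \<zeta>\<^sub>2 > 0 \<and> (\<zeta>\<^sub>1 + \<delta> / \<alpha> * \<zeta>\<^sub>2) * C u\<^sub>\<alpha> u\<^sub>0 < 1}.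
           (e_fun K R \<alpha> \<zeta>\<^sub>1 \<mu>\<^sub>0 + ereal (\<delta> / \<alpha>) * e_fun K R \<delta> \<zeta>\<^sub>2 \<eta>)
           / ereal (1 - (\<zeta>\<^sub>1 + \<delta> / \<alpha> * \<zeta>\<^sub>2) * C u\<^sub>\<alpha> u\<^sub>0)))"
proof -
  define D where "D = sym_bregman \<mu>\<^sub>\<alpha> \<mu>\<^sub>0 u\<^sub>\<alpha> u\<^sub>0"
  define d where "d = u\<^sub>\<alpha> - u\<^sub>0"
  define c where "c = C u\<^sub>\<alpha> u\<^sub>0"
  define N where "N = (norm (K d))\<^sup>2"
  have D_nonneg: "0 \<le> D"
    unfolding D_def by (rule sym_bregman_nonneg[OF \<mu>\<^sub>\<alpha> \<mu>\<^sub>0 R_values R_values])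
  have Rd: "R d \<le> ereal (c * bregman_pow D \<theta>)"
    unfolding d_def c_def D_def by (rule R_bound[OF \<mu>\<^sub>\<alpha> \<mu>\<^sub>0])
  then obtain r where r: "R d = ereal r"
    using R_values[of d] by (cases "R d") auto
  have r_le: "r \<le> c * bregman_pow D \<theta>"
    using Rd r by simp
  have identity: "D = \<delta> / \<alpha> * \<eta> d - \<mu>\<^sub>0 d - N / \<alpha>"
    unfolding D_def d_def N_def \<eta>
    by (rule sym_bregman_error_identity[OF pos(1) K_factor optimality[unfolded data]])
  have basic: "\<exists>A B. ereal A \<le> e_fun K R \<alpha> \<zeta>\<^sub>1 \<mu>\<^sub>0 \<and> ereal B \<le> e_fun K R \<delta> \<zeta>\<^sub>2 \<eta> \<and>
      D \<le> (\<zeta>\<^sub>1 + \<delta> / \<alpha> * \<zeta>\<^sub>2) * (c * bregman_pow D \<theta>) + A + \<delta> / \<alpha> * B"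
    if \<zeta>: "\<zeta>\<^sub>1 > 0" "\<zeta>\<^sub>2 > 0" for \<zeta>\<^sub>1 \<zeta>\<^sub>2
  proof (intro exI conjI)
    show "ereal (- \<mu>\<^sub>0 d - \<zeta>\<^sub>1 * r - N / (2 * \<alpha>)) \<le> e_fun K R \<alpha> \<zeta>\<^sub>1 \<mu>\<^sub>0"
      unfolding N_def by (rule e_fun_lower_bound[where R = R, OF pos(1) \<zeta>(1) r])
    \<comment> \<open>The noise enters the identity with the opposite sign, so that the test point is \<open>- d\<close>.\<close>
    have "R (- d) = ereal r"
      by (simp add: R4 r)
    from e_fun_lower_bound[where R = R and \<xi> = \<eta> and K = K, OF pos(2) \<zeta>(2) this]
    show "ereal (\<eta> d - \<zeta>\<^sub>2 * r - N / (2 * \<delta>)) \<le> e_fun K R \<delta> \<zeta>\<^sub>2 \<eta>"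
      by (simp add: N_def blinfun.minus_right)
    have "D = (\<zeta>\<^sub>1 + \<delta> / \<alpha> * \<zeta>\<^sub>2) * r + (- \<mu>\<^sub>0 d - \<zeta>\<^sub>1 * r - N / (2 * \<alpha>))
        + \<delta> / \<alpha> * (\<eta> d - \<zeta>\<^sub>2 * r - N / (2 * \<delta>))"
      using pos by (simp add: identity field_simps)
    moreover have "(\<zeta>\<^sub>1 + \<delta> / \<alpha> * \<zeta>\<^sub>2) * r \<le> (\<zeta>\<^sub>1 + \<delta> / \<alpha> * \<zeta>\<^sub>2) * (c * bregman_pow D \<theta>)"
      using r_le \<zeta> pos by (intro mult_left_mono) simp_all
    ultimately show "D \<le> (\<zeta>\<^sub>1 + \<delta> / \<alpha> * \<zeta>\<^sub>2) * (c * bregman_pow D \<theta>)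
        + (- \<mu>\<^sub>0 d - \<zeta>\<^sub>1 * r - N / (2 * \<alpha>)) + \<delta> / \<alpha> * (\<eta> d - \<zeta>\<^sub>2 * r - N / (2 * \<delta>))"
      by linarith
  qed
  have less_one: "ereal D \<le>
      ereal ((\<zeta>\<^sub>1 + \<delta> / \<alpha> * \<zeta>\<^sub>2) powr (1 / (1 - \<theta>)) * c powr (1 / (1 - \<theta>)))
      + ereal (1 / (1 - \<theta>)) * e_fun K R \<alpha> \<zeta>\<^sub>1 \<mu>\<^sub>0
      + ereal (\<delta> / (\<alpha> * (1 - \<theta>))) * e_fun K R \<delta> \<zeta>\<^sub>2 \<eta>"
    if \<theta>1: "\<theta> < 1" and \<zeta>: "\<zeta>\<^sub>1 > 0" "\<zeta>\<^sub>2 > 0" for \<zeta>\<^sub>1 \<zeta>\<^sub>2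
  proof -
    obtain A B where A: "ereal A \<le> e_fun K R \<alpha> \<zeta>\<^sub>1 \<mu>\<^sub>0" and B: "ereal B \<le> e_fun K R \<delta> \<zeta>\<^sub>2 \<eta>"
      and D_le: "D \<le> (\<zeta>\<^sub>1 + \<delta> / \<alpha> * \<zeta>\<^sub>2) * (c * bregman_pow D \<theta>) + A + \<delta> / \<alpha> * B"
      using basic[OF \<zeta>] by blast
    define P where "P = (\<zeta>\<^sub>1 + \<delta> / \<alpha> * \<zeta>\<^sub>2) powr (1 / (1 - \<theta>)) * c powr (1 / (1 - \<theta>))"
    have "(\<zeta>\<^sub>1 + \<delta> / \<alpha> * \<zeta>\<^sub>2) * (c * bregman_pow D \<theta>) \<le> (1 - \<theta>) * P + \<theta> * D"
      unfolding P_def using \<zeta> pos \<theta> \<theta>1 D_nonneg by (intro weighted_young) (simp_all add: add_pos_pos)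
    with D_le have "(1 - \<theta>) * D \<le> (1 - \<theta>) * P + A + \<delta> / \<alpha> * B"
      by (simp add: left_diff_distrib)
    then have "D \<le> ((1 - \<theta>) * P + A + \<delta> / \<alpha> * B) / (1 - \<theta>)"
      using \<theta>1 by (simp add: pos_le_divide_eq mult.commute)
    also have "\<dots> = P + 1 / (1 - \<theta>) * A + \<delta> / (\<alpha> * (1 - \<theta>)) * B"
      using \<theta>1 by (simp add: add_divide_distrib)
    finally have "ereal D \<le> ereal P + ereal (1 / (1 - \<theta>)) * ereal A
        + ereal (\<delta> / (\<alpha> * (1 - \<theta>))) * ereal B"
      by simp
    also have "\<dots> \<le> ereal P + ereal (1 / (1 - \<theta>)) * e_fun K R \<alpha> \<zeta>\<^sub>1 \<mu>\<^sub>0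
        + ereal (\<delta> / (\<alpha> * (1 - \<theta>))) * e_fun K R \<delta> \<zeta>\<^sub>2 \<eta>"
      using \<theta>1 pos by (intro add_mono order_refl ereal_mult_left_mono A B) simp_all
    finally show ?thesis
      unfolding P_def .
  qed
  have eq_one: "ereal D \<le>
      (e_fun K R \<alpha> \<zeta>\<^sub>1 \<mu>\<^sub>0 + ereal (\<delta> / \<alpha>) * e_fun K R \<delta> \<zeta>\<^sub>2 \<eta>)
      / ereal (1 - (\<zeta>\<^sub>1 + \<delta> / \<alpha> * \<zeta>\<^sub>2) * c)"
    if \<theta>1: "\<theta> = 1" and \<zeta>: "\<zeta>\<^sub>1 > 0" "\<zeta>\<^sub>2 > 0" and small: "(\<zeta>\<^sub>1 + \<delta> / \<alpha> * \<zeta>\<^sub>2) * c < 1" for \<zeta>\<^sub>1 \<zeta>\<^sub>2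
  proof -
    obtain A B where A: "ereal A \<le> e_fun K R \<alpha> \<zeta>\<^sub>1 \<mu>\<^sub>0" and B: "ereal B \<le> e_fun K R \<delta> \<zeta>\<^sub>2 \<eta>"
      and D_le: "D \<le> (\<zeta>\<^sub>1 + \<delta> / \<alpha> * \<zeta>\<^sub>2) * (c * bregman_pow D \<theta>) + A + \<delta> / \<alpha> * B"
      using basic[OF \<zeta>] by blast
    define M where "M = 1 - (\<zeta>\<^sub>1 + \<delta> / \<alpha> * \<zeta>\<^sub>2) * c"
    have M: "M > 0"
      using small by (simp add: M_def)
    have "bregman_pow D \<theta> = D"
      using D_nonneg by (simp add: bregman_pow_def \<theta>1)
    with D_le have "D * M \<le> A + \<delta> / \<alpha> * B"
      by (simp add: M_def algebra_simps)
    then have "ereal D \<le> (ereal A + ereal (\<delta> / \<alpha>) * ereal B) / ereal M"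
      using M by (simp add: pos_le_divide_eq)
    also have "\<dots> \<le> (e_fun K R \<alpha> \<zeta>\<^sub>1 \<mu>\<^sub>0 + ereal (\<delta> / \<alpha>) * e_fun K R \<delta> \<zeta>\<^sub>2 \<eta>) / ereal M"
      using M pos by (intro ereal_divide_right_mono add_mono ereal_mult_left_mono A B) simp_all
    finally show ?thesis
      unfolding M_def .
  qed
  show ?thesis
    unfolding D_def[symmetric] c_def[symmetric]
  proof (intro conjI impI INF_greatest, goal_cases)
    case (1 \<zeta>)
    then show ?case
      using less_one[of "fst \<zeta>" "snd \<zeta>"] by (simp only: case_prod_beta mem_Times_iff greaterThan_iff)
  next
    case (2 \<zeta>)
    then show ?case
      using eq_one[of "fst \<zeta>" "snd \<zeta>"] by (simp only: case_prod_beta mem_Collect_eq)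
  qed
qed

end
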